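(* Let $n\equiv2\pmod4$, $n\ge6$, and put $m=n/2$. View $n\times n$ complex matrices as $m\times m$ matrices of $2\times2$ blocks, writing $X_{(p,q)}$ for the block in block-row $p$ and block-column $q$ ($1\le p,q\le m$). The solutions $X\in M_n(\mathbb{C})$ of $X^tA_n^2+A_n^2X=0$ are exactly the matrices of the following form, for arbitrary $Z_0,Z_1,\dots,Z_{(n-2)/4}\in M_2(\mathbb{C})$: - $X_{(p,p)}=Z_0$ for $p$ odd and $X_{(p,p)}=-Z_0^t$ for $p$ even; - $X_{(p,q)}=Z_{(q-p+1)/2}$ for $p$ odd, $q$ even, $p<q$; - $X_{(p,q)}=-Z_{(p-q+1)/2}^t$ for $p$ odd, $q$ even, $p>q$; - $X_{(p,q)}=0$ in all other cases.
   Context: $A_n$ is the $n\times n$ matrix with $(A_n)_{i,i+1}=1$ for $1\le i\le n-1$ and zeros elsewhere; $A_n^2$ is its square, so $(A_n^2)_{i,i+2}=1$ for $1\le i\le n-2$ and all other entries are $0$. *)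

theory Defs
  imports Complex_Main "Jordan_Normal_Form.Matrix"
begin

text \<open>Matrices are indexed from \<open>0\<close> as in the library; the index shift does not change
  the superdiagonal.\<close>

definition A_mat :: "nat \<Rightarrow> complex mat" where
  "A_mat n = mat n n (\<lambda>(i, j). if j = i + 1 then 1 else 0)"

text \<open>Block positions \<open>p, q\<close> are counted from \<open>1\<close>, because the solution form depends on their
  parity. Only \<open>p, q \<ge> 1\<close> within the range of the matrix are meaningful.\<close>

definition block2 :: "complex mat \<Rightarrow> nat \<Rightarrow> nat \<Rightarrow> complex mat" where
  "block2 X p q = mat 2 2 (\<lambda>(i, j). X $$ (2 * (p - 1) + i, 2 * (q - 1) + j))"

text \<open>The divisions by \<open>2\<close> are exact, and the subtractions do not truncate, in the cases in which
  they are used.\<close>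

definition solution_block :: "(nat \<Rightarrow> complex mat) \<Rightarrow> nat \<Rightarrow> nat \<Rightarrow> complex mat" where
  "solution_block Z p q =
    (if p = q \<and> odd p then Z 0
     else if p = q \<and> even p then - (Z 0)\<^sup>T
     else if odd p \<and> even q \<and> p < q then Z ((q - p + 1) div 2)
     else if odd p \<and> even q \<and> p > q then - (Z ((p - q + 1) div 2))\<^sup>T
     else 0\<^sub>m 2 2)"

text \<open>Prescribing all \<open>2 \<times> 2\<close> blocks determines exactly one matrix; in particular every choice of
  the \<open>Z\<close> is realised by a matrix whose blocks are \<open>solution_block Z p q\<close>.\<close>

lemma ex1_block2:
  assumes B: "\<And>p q. p \<in> {1..m} \<Longrightarrow> q \<in> {1..m} \<Longrightarrow> B p q \<in> carrier_mat 2 2"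
  shows "\<exists>!X. X \<in> carrier_mat (2 * m) (2 * m) \<and>
           (\<forall>p\<in>{1..m}. \<forall>q\<in>{1..m}. block2 X p q = B p q)"
proof -
  define Y where "Y = mat (2 * m) (2 * m)
    (\<lambda>(i, j). B (i div 2 + 1) (j div 2 + 1) $$ (i mod 2, j mod 2))"
  have Yblock: "block2 Y p q = B p q" if pq: "p \<in> {1..m}" "q \<in> {1..m}" for p q
  proof (rule eq_matI)
    fix i j
    assume "i < dim_row (B p q)" and "j < dim_col (B p q)"
    then have ij: "i < 2" "j < 2" using B[OF pq] by auto
    have lt: "2 * (p - 1) + i < 2 * m" "2 * (q - 1) + j < 2 * m" using pq ij by auto
    have "(2 * (p - 1) + i) div 2 + 1 = p" "(2 * (q - 1) + j) div 2 + 1 = q"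
      "(2 * (p - 1) + i) mod 2 = i" "(2 * (q - 1) + j) mod 2 = j" using pq ij by auto
    then show "block2 Y p q $$ (i, j) = B p q $$ (i, j)"
      using ij lt by (simp add: block2_def Y_def del: div_mult_self1 div_mult_self2)
  qed (use B[OF pq] in \<open>auto simp: block2_def\<close>)
  have uniq: "X = Y" if X: "X \<in> carrier_mat (2 * m) (2 * m)"
    and blocks: "\<forall>p\<in>{1..m}. \<forall>q\<in>{1..m}. block2 X p q = B p q" for X
  proof (rule eq_matI)
    fix i j
    assume "i < dim_row Y" and "j < dim_col Y"
    then have ij: "i < 2 * m" "j < 2 * m" by (auto simp: Y_def)
    have pq: "i div 2 + 1 \<in> {1..m}" "j div 2 + 1 \<in> {1..m}" using ij by auto
    have "X $$ (i, j) = block2 X (i div 2 + 1) (j div 2 + 1) $$ (i mod 2, j mod 2)"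
      by (simp add: block2_def)
    also have "\<dots> = B (i div 2 + 1) (j div 2 + 1) $$ (i mod 2, j mod 2)"
      using blocks pq by simp
    also have "\<dots> = Y $$ (i, j)" using ij by (simp add: Y_def)
    finally show "X $$ (i, j) = Y $$ (i, j)" .
  qed (use X in \<open>auto simp: Y_def\<close>)
  have "Y \<in> carrier_mat (2 * m) (2 * m)" by (simp add: Y_def)
  with Yblock uniq show ?thesis by blast
qed

end

theory Submission
  imports Defs
begin

text \<open>Blockwise the equation reads \<open>X (p + 1) q = - (X (q - 1) p)\<^sup>T\<close>, where blocks outside the
  matrix count as \<open>0\<close>. Applied twice, it shows that the blocks are constant along the diagonals in
  steps of two. The first column vanishes below its top entry and the last column above its bottom
  entry. Since \<open>m\<close> is odd, every off-diagonal block with odd column index can be shifted into one of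
  these two columns and is \<open>0\<close>. The other blocks on or above the diagonal in an odd row are shifted
  into the first row, whose block \<open>(1, 1)\<close> and blocks in even columns are free. The remaining blocks
  are negated transposes of those already treated.\<close>

section \<open>Entries of the left-hand side of the equation\<close>

lemma sum_indicator_mult:
  fixes f :: "nat \<Rightarrow> 'a :: semiring_1"
  shows "(\<Sum>k\<in>{0..<n}. (if k = a then 1 else 0) * f k) = (if a < n then f a else 0)"
proof -
  have "(if k = a then 1 else 0) * f k = (if k = a then f k else 0)" for k by simp
  then show ?thesis by simp
qed

lemma A_mat_power2:
  "A_mat n ^\<^sub>m 2 = mat n n (\<lambda>(i, j). if j = i + 2 then 1 else 0)"
proof -
  have "(A_mat n * A_mat n) $$ (i, j) = (if j = i + 2 then 1 else 0)"
    if "i < n" "j < n" for i j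
  proof -
    have "(A_mat n * A_mat n) $$ (i, j) =
        (\<Sum>k\<in>{0..<n}. (if k = i + 1 then 1 else 0) * (if j = k + 1 then 1 else 0))"
      using that by (simp add: A_mat_def scalar_prod_def)
    also have "\<dots> = (if j = i + 2 then 1 else 0)"
      using that by (subst sum_indicator_mult) auto
    finally show ?thesis .
  qed
  moreover have "A_mat n ^\<^sub>m 2 = A_mat n * A_mat n"
    by (simp add: numeral_2_eq_2 A_mat_def)
  ultimately show ?thesis
    by (intro eq_matI) (auto simp: A_mat_def)
qed

text \<open>Multiplying by \<open>A_mat n ^\<^sub>m 2\<close> on the right moves columns two places
  to the right, and on the left moves rows two places up; zeros enter at the border.\<close>

lemma index_equation_lhs:
  assumes X: "X \<in> carrier_mat n n" and ij: "i < n" "j < n"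
  shows "(X\<^sup>T * (A_mat n ^\<^sub>m 2) + (A_mat n ^\<^sub>m 2) * X) $$ (i, j) =
    (if 2 \<le> j then X $$ (j - 2, i) else 0) + (if i + 2 < n then X $$ (i + 2, j) else 0)"
proof -
  let ?A = "mat n n (\<lambda>(i, j). if j = i + 2 then 1 else 0) :: complex mat"
  have "(X\<^sup>T * ?A) $$ (i, j) = (\<Sum>k\<in>{0..<n}. X $$ (k, i) * (if j = k + 2 then 1 else 0))"
    using X ij by (simp add: scalar_prod_def)
  \<comment> \<open>The guard \<open>2 \<le> j\<close> is needed once \<open>j = k + 2\<close> is
    solved for \<open>k\<close>, because \<open>j - 2\<close> is truncated to \<open>0\<close> for
    smaller \<open>j\<close>.\<close>
  also have "\<dots> = (\<Sum>k\<in>{0..<n}. if k = j - 2 then (if 2 \<le> j then X $$ (k, i) else 0) else 0)"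
    by (rule sum.cong) auto
  also have "\<dots> = (if 2 \<le> j then X $$ (j - 2, i) else 0)"
    using ij by (auto simp: sum.delta)
  finally have 1: "(X\<^sup>T * ?A) $$ (i, j) = (if 2 \<le> j then X $$ (j - 2, i) else 0)" .
  have "(?A * X) $$ (i, j) = (\<Sum>k\<in>{0..<n}. (if k = i + 2 then 1 else 0) * X $$ (k, j))"
    using X ij by (simp add: scalar_prod_def)
  also have "\<dots> = (if i + 2 < n then X $$ (i + 2, j) else 0)"
    by (rule sum_indicator_mult)
  finally show ?thesis
    using X ij 1 by (simp add: A_mat_power2)
qed

section \<open>The equation in blocks\<close>

lemma block2_carrier [simp]: "block2 X p q \<in> carrier_mat 2 2"
  by (simp add: block2_def)

lemma block2_index:
  "i < 2 \<Longrightarrow> j < 2 \<Longrightarrow> block2 X p q $$ (i, j) = X $$ (2 * (p - 1) + i, 2 * (q - 1) + j)"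
  by (simp add: block2_def)

text \<open>The zero matrix has only zero blocks, and by the uniqueness in \<open>ex1_block2\<close>
  it is the only such matrix of its size.\<close>

lemma eq_zero_iff_blocks:
  assumes "X \<in> carrier_mat (2 * m) (2 * m)"
  shows "X = 0\<^sub>m (2 * m) (2 * m) \<longleftrightarrow>
    (\<forall>p\<in>{1..m}. \<forall>q\<in>{1..m}. block2 X p q = 0\<^sub>m 2 2)"
proof -
  let ?P = "\<lambda>X. X \<in> carrier_mat (2 * m) (2 * m) \<and>
    (\<forall>p\<in>{1..m}. \<forall>q\<in>{1..m}. block2 X p q = 0\<^sub>m 2 2)"
  have "block2 (0\<^sub>m (2 * m) (2 * m)) p q = 0\<^sub>m 2 2" if "p \<in> {1..m}" "q \<in> {1..m}" for p q
    using that by (intro eq_matI) (auto simp: block2_def)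
  then have "?P (0\<^sub>m (2 * m) (2 * m))" by simp
  moreover have "\<exists>!X. ?P X" by (rule ex1_block2) simp
  ultimately show ?thesis using assms by metis
qed

text \<open>A shift by two entries is a shift by one whole block, so the offsets \<open>i\<close>,
  \<open>j\<close> inside a block are preserved and the border conditions depend only on
  \<open>p\<close> and \<open>q\<close>.\<close>

lemma block2_equation_lhs:
  assumes X: "X \<in> carrier_mat (2 * m) (2 * m)" and pq: "p \<in> {1..m}" "q \<in> {1..m}"
  shows "block2 (X\<^sup>T * (A_mat (2 * m) ^\<^sub>m 2) + (A_mat (2 * m) ^\<^sub>m 2) * X) p q =
    (if 2 \<le> q then (block2 X (q - 1) p)\<^sup>T else 0\<^sub>m 2 2) +
    (if p < m then block2 X (p + 1) q else 0\<^sub>m 2 2)" (is "_ = ?R")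
proof (rule eq_matI)
  fix i j assume "i < dim_row ?R" "j < dim_col ?R"
  then have ij: "i < 2" "j < 2"
    by (auto simp: block2_def split: if_splits)
  obtain r s where rs: "p = r + 1" "q = s + 1"
    using pq by (metis atLeastAtMost_iff le_add_diff_inverse2)
  have "2 \<le> 2 * s + j \<longleftrightarrow> 1 \<le> s" "2 * r + i + 2 < 2 * m \<longleftrightarrow> r + 1 < m"
    "2 * r + i < 2 * m" "2 * s + j < 2 * m"
    "1 \<le> s \<Longrightarrow> 2 * s + j - 2 = 2 * (s - 1) + j"
    using ij pq rs by auto
  then show "block2 (X\<^sup>T * (A_mat (2 * m) ^\<^sub>m 2) + (A_mat (2 * m) ^\<^sub>m 2) * X) p q $$ (i, j) =
      ?R $$ (i, j)"
    using ij rs by (simp add: block2_index index_equation_lhs[OF X] block2_def)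
qed (auto simp: block2_def)

lemma equation_iff_blocks:
  assumes X: "X \<in> carrier_mat (2 * m) (2 * m)"
  shows "X\<^sup>T * (A_mat (2 * m) ^\<^sub>m 2) + (A_mat (2 * m) ^\<^sub>m 2) * X = 0\<^sub>m (2 * m) (2 * m) \<longleftrightarrow>
    (\<forall>p\<in>{1..m}. \<forall>q\<in>{1..m}. (if 2 \<le> q then (block2 X (q - 1) p)\<^sup>T else 0\<^sub>m 2 2) +
      (if p < m then block2 X (p + 1) q else 0\<^sub>m 2 2) = 0\<^sub>m 2 2)"
proof -
  have "X\<^sup>T * (A_mat (2 * m) ^\<^sub>m 2) + (A_mat (2 * m) ^\<^sub>m 2) * X \<in> carrier_mat (2 * m) (2 * m)"
    using X unfolding A_mat_power2
    by (intro add_carrier_mat mult_carrier_mat[of _ _ "2 * m"]) auto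
  then show ?thesis
    using X by (simp add: eq_zero_iff_blocks block2_equation_lhs)
qed

section \<open>Solving the block equation\<close>

lemma uminus_transpose_transpose:
  fixes A :: "'a :: group_add mat"
  shows "- (- A\<^sup>T)\<^sup>T = A"
  by (intro eq_matI) auto

lemma add_eq_zero_mat_iff:
  fixes A B :: "'a :: ab_group_add mat"
  assumes "A \<in> carrier_mat k l" "B \<in> carrier_mat k l"
  shows "A + B = 0\<^sub>m k l \<longleftrightarrow> B = - A"
  using assms by (auto simp: mat_eq_iff add_eq_0_iff)

text \<open>Passing from position \<open>(r, p)\<close> to \<open>(p + 1, r + 1)\<close> exchanges
  odd and even diagonal positions, and exchanges the positions with odd row and even column above
  the diagonal with those below it, keeping the index of \<open>Z\<close>. All other off-diagonal
  positions carry zero and are mapped among themselves.\<close>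

lemma solution_block_equation:
  assumes "odd m" and pq: "p \<in> {1..m}" "q \<in> {1..m}"
    and Z: "\<forall>k\<le>(m - 1) div 2. Z k \<in> carrier_mat 2 2"
  shows "(if 2 \<le> q then (solution_block Z (q - 1) p)\<^sup>T else 0\<^sub>m 2 2) +
      (if p < m then solution_block Z (p + 1) q else 0\<^sub>m 2 2) = 0\<^sub>m 2 2"
proof -
  have neg: "A\<^sup>T + - A\<^sup>T = 0\<^sub>m 2 2" "(- A\<^sup>T)\<^sup>T + A = 0\<^sub>m 2 2"
    if "A \<in> carrier_mat 2 2" for A :: "complex mat"
    using that by (auto intro!: eq_matI)
  consider (bottom_left) "p = m" "q = 1" | (bottom) "p = m" "2 \<le> q" | (left) "p < m" "q = 1"
    | (inner) "p < m" "2 \<le> q"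
    using pq by fastforce
  then show ?thesis
  proof cases
    case bottom
    \<comment> \<open>The block lies off the diagonal in column \<open>m\<close>, which is
      odd.\<close>
    with \<open>odd m\<close> pq have "solution_block Z (q - 1) p = 0\<^sub>m 2 2"
      by (auto simp: solution_block_def)
    with bottom show ?thesis by simp
  next
    case left
    with pq show ?thesis by (auto simp: solution_block_def)
  next
    case inner
    then obtain r where q: "q = r + 1" "r \<ge> 1" using pq by (cases q) auto
    consider "r = p" "odd p" | "r = p" "even p" | "odd r" "even p" "r < p" | "odd r" "even p" "r > p"
      | "r \<noteq> p" "\<not> (odd r \<and> even p)" by linarith
    then have "(solution_block Z r p)\<^sup>T + solution_block Z (p + 1) (r + 1) = 0\<^sub>m 2 2"
    proof cases
      case 3
      \<comment> \<open>The index is in range because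
        \<open>p - r + 1 \<le> p \<le> m - 1\<close>.\<close>
      then have "Z ((p - r + 1) div 2) \<in> carrier_mat 2 2"
        using inner q by (intro Z[rule_format] div_le_mono) auto
      with 3 show ?thesis by (simp add: solution_block_def neg)
    next
      case 4
      then have "Z ((r - p + 1) div 2) \<in> carrier_mat 2 2"
        using inner q pq by (intro Z[rule_format] div_le_mono) auto
      with 4 show ?thesis by (simp add: solution_block_def neg)
    qed (use Z in \<open>auto simp: solution_block_def neg\<close>)
    with inner q show ?thesis by simp
  qed simp
qed

text \<open>The parameters are read off the first block row: \<open>Z 0\<close> is block (1, 1), and
  \<open>Z k\<close> is block (1, 2 k) for positive \<open>k\<close>; the \<open>max\<close> merges
  the two cases.\<close>

lemma block_equation_solution:
  fixes B :: "nat \<Rightarrow> nat \<Rightarrow> complex mat"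
  assumes "odd m" and carrier: "\<And>p q. B p q \<in> carrier_mat 2 2"
    and eq: "\<And>p q. p \<in> {1..m} \<Longrightarrow> q \<in> {1..m} \<Longrightarrow>
      (if 2 \<le> q then (B (q - 1) p)\<^sup>T else 0\<^sub>m 2 2) +
      (if p < m then B (p + 1) q else 0\<^sub>m 2 2) = 0\<^sub>m 2 2"
    and pq: "p \<in> {1..m}" "q \<in> {1..m}"
  shows "B p q = solution_block (\<lambda>k. B 1 (max 1 (2 * k))) p q"
proof -
  have flip: "B (p + 1) (q + 1) = - (B q p)\<^sup>T"
    if "1 \<le> p" "p < m" "1 \<le> q" "q < m" for p q
    using eq[of p "q + 1"] that carrier by (simp add: add_eq_zero_mat_iff)
  have first_column: "B p 1 = 0\<^sub>m 2 2" if "2 \<le> p" "p \<le> m" for p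
  proof -
    obtain r where "p = r + 1" "1 \<le> r" using \<open>2 \<le> p\<close> by (cases p) auto
    then have "0\<^sub>m 2 2 + B p 1 = 0\<^sub>m 2 2" using eq[of r 1] that by simp
    then show ?thesis using carrier by simp
  qed
  have last_column: "B q m = 0\<^sub>m 2 2" if "1 \<le> q" "q < m" for q
  proof -
    have "(B q m)\<^sup>T + 0\<^sub>m 2 2 = 0\<^sub>m 2 2" using eq[of m "q + 1"] that by simp
    then have "(B q m)\<^sup>T = 0\<^sub>m 2 2" using carrier by simp
    then show ?thesis by (metis transpose_transpose zero_transpose_mat)
  qed
  have shift: "B (p + 2 * k) (q + 2 * k) = B p q"
    if "1 \<le> p" "1 \<le> q" "p + 2 * k \<le> m" "q + 2 * k \<le> m" for p q k
    using that
  proof (induction k)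
    case (Suc k)
    have "B (p + 2 * Suc k) (q + 2 * Suc k) = - (B (q + 2 * k + 1) (p + 2 * k + 1))\<^sup>T"
      using flip[of "p + 2 * k + 1" "q + 2 * k + 1"] Suc.prems by simp
    also have "B (q + 2 * k + 1) (p + 2 * k + 1) = - (B (p + 2 * k) (q + 2 * k))\<^sup>T"
      using flip[of "q + 2 * k" "p + 2 * k"] Suc.prems by simp
    finally show ?case
      using Suc by (simp add: uminus_transpose_transpose)
  qed simp
  have below: "B p q = 0\<^sub>m 2 2" if "odd q" "q < p" "p \<le> m" for p q
  proof -
    obtain k where "q = 1 + 2 * k" using \<open>odd q\<close> by (metis oddE add.commute)
    then show ?thesis
      using shift[of "p - 2 * k" 1 k] first_column[of "p - 2 * k"] that by simp
  qed
  have above: "B p q = 0\<^sub>m 2 2" if "odd q" "1 \<le> p" "p < q" "q \<le> m" for p q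
  proof -
    have "even (m - q)" using \<open>odd m\<close> that by simp
    then obtain k where "m - q = 2 * k" by (rule evenE)
    then have "m = q + 2 * k" using that by simp
    \<comment> \<open>The shift takes column \<open>q\<close> to column \<open>m\<close>, and
      \<open>p < q\<close> keeps the new row \<open>p + 2 * k\<close> above the bottom row.\<close>
    then show ?thesis
      using shift[of p q k] last_column[of "p + 2 * k"] that by simp
  qed
  have first_row: "B p q = B 1 (q - p + 1)" if "odd p" "p \<le> q" "q \<le> m" for p q
  proof -
    obtain k where "p = 1 + 2 * k" using \<open>odd p\<close> by (metis oddE add.commute)
    then show ?thesis using shift[of 1 "q - p + 1" k] that by simp
  qed
  have flip': "B p q = - (B (q - 1) (p - 1))\<^sup>T" if "2 \<le> p" "p \<le> m" "2 \<le> q" "q \<le> m" for p q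
    using flip[of "p - 1" "q - 1"] that by simp
  \<comment> \<open>This undoes the halving in \<open>solution_block\<close>: with odd row and even
    column the difference of the positions is odd, so doubling the index of \<open>Z\<close>
    recovers the column in the first row.\<close>
  have double: "2 * ((k + 1) div 2) = k + 1" if "odd k" for k :: nat
    using that by presburger
  consider (diag_odd) "p = q" "odd p" | (diag_even) "p = q" "even p"
    | (upper) "odd p" "even q" "p < q" | (lower) "odd p" "even q" "p > q"
    | (odd_col) "odd q" "p \<noteq> q" | (even_even) "even p" "even q" "p \<noteq> q" by linarith
  then show ?thesis
  proof cases
    case diag_odd
    then show ?thesis using first_row[of p q] pq by (simp add: solution_block_def)
  next
    case diag_even
    then have "2 \<le> p" using pq by (auto dest: dvd_imp_le)
    then show ?thesis
      using diag_even flip'[of p p] first_row[of "p - 1" "p - 1"] pq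
      by (simp add: solution_block_def)
  next
    case upper
    then show ?thesis
      using first_row[of p q] pq double[of "q - p"] by (simp add: solution_block_def)
  next
    case lower
    \<comment> \<open>One flip leads to the odd row \<open>q - 1\<close> on or above the diagonal,
      and from there a shift leads to column \<open>p - q + 1\<close> of the first row.\<close>
    then have "2 \<le> q" "q - 1 \<le> p - 1" using pq by (auto dest: dvd_imp_le)
    then show ?thesis
      using lower flip'[of p q] first_row[of "q - 1" "p - 1"] pq double[of "p - q"]
      by (simp add: solution_block_def)
  next
    case odd_col
    then show ?thesis using below[of q p] above[of q p] pq
      by (cases "p < q") (auto simp: solution_block_def)
  next
    case even_even
    then have "2 \<le> p" "2 \<le> q" using pq by (auto dest: dvd_imp_le)
    \<comment> \<open>One flip turns the even column into the odd column \<open>p - 1\<close>, still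
      off the diagonal.\<close>
    moreover have "B (q - 1) (p - 1) = 0\<^sub>m 2 2"
      using even_even calculation below[of "p - 1" "q - 1"] above[of "p - 1" "q - 1"] pq
      by (cases "p < q") auto
    ultimately show ?thesis
      using even_even flip'[of p q] pq by (auto simp: solution_block_def)
  qed
qed

theorem proposition5p5:
  fixes n m :: nat
  assumes "n mod 4 = 2" and "n \<ge> 6" and "m = n div 2"
  shows "{X \<in> carrier_mat n n. X\<^sup>T * (A_mat n ^\<^sub>m 2) + (A_mat n ^\<^sub>m 2) * X = 0\<^sub>m n n} =
    {X \<in> carrier_mat n n. \<exists>Z :: nat \<Rightarrow> complex mat.
       (\<forall>k \<le> (n - 2) div 4. Z k \<in> carrier_mat 2 2) \<and>
       (\<forall>p\<in>{1..m}. \<forall>q\<in>{1..m}. block2 X p q = solution_block Z p q)}"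
proof -
  define k where "k = n div 4"
  \<comment> \<open>Hence \<open>m = 2 * k + 1\<close> is odd, and both bounds for the indices of
    \<open>Z\<close> equal \<open>k\<close>.\<close>
  have "n = 4 * k + 2" using assms(1) mult_div_mod_eq[of 4 n] by (simp add: k_def)
  then have n: "n = 2 * m" and "odd m" and range: "(n - 2) div 4 = (m - 1) div 2"
    using assms(3) by auto
  have "X\<^sup>T * (A_mat n ^\<^sub>m 2) + (A_mat n ^\<^sub>m 2) * X = 0\<^sub>m n n \<longleftrightarrow>
      (\<exists>Z. (\<forall>k \<le> (n - 2) div 4. Z k \<in> carrier_mat 2 2) \<and>
       (\<forall>p\<in>{1..m}. \<forall>q\<in>{1..m}. block2 X p q = solution_block Z p q))" (is "?E \<longleftrightarrow> ?S")
    if "X \<in> carrier_mat n n" for X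
  proof
    assume ?E
    with \<open>X \<in> carrier_mat n n\<close> have "block2 X p q =
        solution_block (\<lambda>k. block2 X 1 (max 1 (2 * k))) p q"
      if "p \<in> {1..m}" "q \<in> {1..m}" for p q
      using that unfolding n
      by (intro block_equation_solution[OF \<open>odd m\<close>] block2_carrier equation_iff_blocks[THEN iffD1, rule_format])
    then show ?S
      by (intro exI[of _ "\<lambda>k. block2 X 1 (max 1 (2 * k))"]) simp
  next
    assume ?S
    then obtain Z where Z: "\<forall>k\<le>(m - 1) div 2. Z k \<in> carrier_mat 2 2"
      and X: "\<And>p q. p \<in> {1..m} \<Longrightarrow> q \<in> {1..m} \<Longrightarrow> block2 X p q = solution_block Z p q"
      unfolding range by blast
    have "(if 2 \<le> q then (block2 X (q - 1) p)\<^sup>T else 0\<^sub>m 2 2) +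
        (if p < m then block2 X (p + 1) q else 0\<^sub>m 2 2) = 0\<^sub>m 2 2"
      if "p \<in> {1..m}" "q \<in> {1..m}" for p q
    proof -
      \<comment> \<open>The blocks of \<open>X\<close> are known only inside the matrix, so each
        replacement is made under the guard that keeps its position there.\<close>
      have "2 \<le> q \<Longrightarrow> block2 X (q - 1) p = solution_block Z (q - 1) p"
        "p < m \<Longrightarrow> block2 X (p + 1) q = solution_block Z (p + 1) q"
        using that by (auto intro!: X)
      then show ?thesis
        using solution_block_equation[OF \<open>odd m\<close> that Z] by (simp cong: if_cong)
    qed
    then show ?E
      using \<open>X \<in> carrier_mat n n\<close> unfolding n
      by (intro equation_iff_blocks[THEN iffD2] ballI)
  qed
  then show ?thesis by blast
qed

end
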